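(* Let $N\ge2$ be an integer and $\lambda<0$. Consider the equation $$-w''+(N-2)w'+(N-1)w=\frac{N-1}{2}e^{-t}w^2+\lambda e^{(N-3)t}\int_0^{e^{-t}}g(s)\,ds \qquad (\ast)$$ and the three problems: (D) $w\in C^2([0,\infty))$ solves $(\ast)$ for $t\ge0$ with $w(0)=0$, $\lim_{t\to\infty}w(t)=0$, where $g\in L^1([0,1])$ and $\lim_{t\to\infty}e^{(N-3)t}\int_0^{e^{-t}}g(s)\,ds=0$; (Nav) $w\in C^2([0,\infty))$ solves $(\ast)$ for $t\ge0$ with $w'(0)-(N-1)w(0)=0$, $\lim_{t\to\infty}w(t)=0$, with $g$ as in (D); (E) $w\in C^2(\mathbb{R})$ solves $(\ast)$ for $t\in\mathbb{R}$ with $\lim_{t\to\pm\infty}w(t)=0$, where $g\in L^1([0,\infty))$ and $\lim_{t\to\pm\infty}e^{(N-3)t}\int_0^{e^{-t}}g(s)\,ds=0$. Assume in each case that $g\ge0$ a.e. and $\operatorname{ess\,sup}g>0$. Then each of the problems (D), (Nav), (E) has at least one solution.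
   Context: These are the radial Dirichlet, Navier and entire problems for $\Delta^2u=S_2[u]+\lambda f$ ($S_2$ the sum of $2\times2$ principal minors of the Hessian), obtained via $v=u'$, $w(t)=-v(e^{-t})$. *)

theory Defs
  imports "HOL-Analysis.Analysis" "HOL-Probability.Essential_Supremum"
begin

definition src :: "nat \<Rightarrow> (real \<Rightarrow> real) \<Rightarrow> real \<Rightarrow> real" where
  "src N g t = exp ((real N - 3) * t) * (LINT s:{0..exp (- t)}|lborel. g s)"

text \<open>The ODE  -w'' + (N-2) w' + (N-1) w = (N-1)/2 e^-t w^2 + lambda * src  at the point t,
  with w1, w2 standing for the first and second derivatives of w.\<close>
definition ode_at :: "nat \<Rightarrow> real \<Rightarrow> (real \<Rightarrow> real) \<Rightarrow> (real \<Rightarrow> real) \<Rightarrow> (real \<Rightarrow> real)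
    \<Rightarrow> (real \<Rightarrow> real) \<Rightarrow> real \<Rightarrow> bool" where
  "ode_at N lam g w w1 w2 t \<longleftrightarrow>
     - w2 t + (real N - 2) * w1 t + (real N - 1) * w t
       = (real N - 1) / 2 * exp (- t) * (w t)^2 + lam * src N g t"

definition C2_with :: "real set \<Rightarrow> (real \<Rightarrow> real) \<Rightarrow> (real \<Rightarrow> real) \<Rightarrow> (real \<Rightarrow> real) \<Rightarrow> bool" where
  "C2_with S w w1 w2 \<longleftrightarrow>
     (\<forall>t\<in>S. (w has_real_derivative w1 t) (at t within S)
           \<and> (w1 has_real_derivative w2 t) (at t within S))
     \<and> continuous_on S w2"

definition g_hyp_D :: "nat \<Rightarrow> (real \<Rightarrow> real) \<Rightarrow> bool" where
  "g_hyp_D N g \<longleftrightarrow>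
     set_integrable lborel {0..1} g
     \<and> ((\<lambda>t. src N g t) \<longlongrightarrow> 0) at_top
     \<and> (AE s in lborel. s \<in> {0..1} \<longrightarrow> g s \<ge> 0)
     \<and> esssup (restrict_space lborel {0..1}) (\<lambda>s. ereal (g s)) > 0"

definition g_hyp_E :: "nat \<Rightarrow> (real \<Rightarrow> real) \<Rightarrow> bool" where
  "g_hyp_E N g \<longleftrightarrow>
     set_integrable lborel {0..} g
     \<and> ((\<lambda>t. src N g t) \<longlongrightarrow> 0) at_top
     \<and> ((\<lambda>t. src N g t) \<longlongrightarrow> 0) at_bot
     \<and> (AE s in lborel. s \<in> {0..} \<longrightarrow> g s \<ge> 0)
     \<and> esssup (restrict_space lborel {0..}) (\<lambda>s. ereal (g s)) > 0"

definition solves_D :: "nat \<Rightarrow> real \<Rightarrow> (real \<Rightarrow> real) \<Rightarrow> (real \<Rightarrow> real) \<Rightarrow> bool" where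
  "solves_D N lam g w \<longleftrightarrow> (\<exists>w1 w2. C2_with {0..} w w1 w2
     \<and> (\<forall>t\<ge>0. ode_at N lam g w w1 w2 t)
     \<and> w 0 = 0 \<and> (w \<longlongrightarrow> 0) at_top)"

definition solves_Nav :: "nat \<Rightarrow> real \<Rightarrow> (real \<Rightarrow> real) \<Rightarrow> (real \<Rightarrow> real) \<Rightarrow> bool" where
  "solves_Nav N lam g w \<longleftrightarrow> (\<exists>w1 w2. C2_with {0..} w w1 w2
     \<and> (\<forall>t\<ge>0. ode_at N lam g w w1 w2 t)
     \<and> w1 0 - (real N - 1) * w 0 = 0 \<and> (w \<longlongrightarrow> 0) at_top)"

definition solves_E :: "nat \<Rightarrow> real \<Rightarrow> (real \<Rightarrow> real) \<Rightarrow> (real \<Rightarrow> real) \<Rightarrow> bool" where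
  "solves_E N lam g w \<longleftrightarrow> (\<exists>w1 w2. C2_with UNIV w w1 w2
     \<and> (\<forall>t. ode_at N lam g w w1 w2 t)
     \<and> (w \<longlongrightarrow> 0) at_top \<and> (w \<longlongrightarrow> 0) at_bot)"

end

theory Submission
  imports Defs "HOL-Complex_Analysis.Residue_Theorem" "HOL-Real_Asymp.Real_Asymp"
begin

text \<open>With \<open>m = N - 1\<close>, the function \<open>z = - w\<close> has to solve
  \<open>- z'' + (m - 1) z' + m z = f - q z\<^sup>2\<close>, where \<open>f = - \<lambda> src\<close> and \<open>q = m / 2 exp (- t)\<close> are
  nonnegative. The left-hand side is \<open>- (D - m) (D + 1) z\<close>. Adding \<open>k (m + 1 + k) z\<close> to both sides
  replaces the factors by \<open>D - (m + k)\<close> and \<open>D + (1 + k)\<close>, whose inverse preserves positivity; for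
  large \<open>k\<close> the right-hand side is nonnegative, nondecreasing and Lipschitz for \<open>z\<close> between \<open>0\<close> and
  a supersolution \<open>\<rho>\<close>, with a Lipschitz constant smaller than \<open>(m + k) (1 + k)\<close>, so Banach's theorem
  applies in the order interval \<open>[0, \<rho>]\<close>. On the half-line \<open>\<rho>\<close> is a constant, and the Dirichlet and
  Navier conditions are the cases \<open>\<gamma> = 0\<close> and \<open>\<gamma> = 1 / N\<close> of \<open>w(0) = \<gamma> (w(0) + w'(0))\<close>. On the
  line \<open>\<rho> = C exp t\<close> works for \<open>N \<ge> 4\<close>, while for \<open>N \<le> 3\<close> the decay of the source at \<open>-\<infinity>\<close> forces
  it to vanish.\<close>

section \<open>First-order linear equations\<close>

lemma continuous_has_antiderivative:
  fixes F :: "real \<Rightarrow> real"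
  assumes "continuous_on UNIV F"
  obtains G where "\<And>t. (G has_real_derivative F t) (at t)"
proof -
  have "\<exists>G. \<forall>x::real. -\<infinity> < ereal x \<longrightarrow> ereal x < \<infinity> \<longrightarrow> (G has_vector_derivative F x) (at x)"
    using assms by (intro einterval_antiderivative) (auto simp: continuous_on_eq_continuous_at)
  then show ?thesis
    using that by (auto simp: has_real_derivative_iff_has_vector_derivative)
qed

lemma mono_antimono_separation:
  fixes U V :: "'a::linorder \<Rightarrow> 'b::conditionally_complete_lattice"
  assumes "mono V" "antimono U" "\<And>t. V t \<le> U t"
  obtains c where "\<And>t. V t \<le> c" "\<And>t. c \<le> U t"
proof
  have VU: "V s \<le> U t" for s t
  proof -
    have "V s \<le> V (max s t)" using \<open>mono V\<close> by (simp add: monoD)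
    also have "\<dots> \<le> U (max s t)" by (rule assms)
    also have "\<dots> \<le> U t" using \<open>antimono U\<close> by (simp add: antimonoD)
    finally show ?thesis .
  qed
  then have "bdd_above (range V)" by (auto intro!: bdd_aboveI)
  then show "V t \<le> (SUP s. V s)" "(SUP s. V s) \<le> U t" for t
    by (auto intro!: cSUP_upper cSUP_least VU)
qed

lemma exp_decaying_derivative_limit_estimate:
  fixes G :: "real \<Rightarrow> real"
  assumes G: "\<And>t. (G has_real_derivative g t) (at t)"
    and g: "\<And>t. \<bar>g t\<bar> \<le> M * exp (- a * t)" and a: "a > 0"
  obtains c where "\<And>t. \<bar>c - G t\<bar> \<le> M / a * exp (- a * t)"
proof -
  define E where "E t = M / a * exp (- a * t)" for t
  have E: "(E has_real_derivative - (M * exp (- a * t))) (at t)" for t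
    unfolding E_def using a by (auto intro!: derivative_eq_intros)
  have g_bounds: "- (M * exp (- a * t)) \<le> g t" "g t \<le> M * exp (- a * t)" for t
    using g[of t] by (simp_all add: abs_le_iff)
  have "mono (\<lambda>t. G t - E t)"
  proof (rule monoI, rule DERIV_nonneg_imp_nondecreasing[of _ _ "\<lambda>t. G t - E t"])
    show "\<exists>y. ((\<lambda>t. G t - E t) has_real_derivative y) (at t) \<and> 0 \<le> y" for t
      using DERIV_diff[OF G E] g_bounds(1)[of t] by (intro exI conjI) auto
  qed
  moreover have "antimono (\<lambda>t. G t + E t)"
  proof (rule antimonoI, rule DERIV_nonpos_imp_nonincreasing[of _ _ "\<lambda>t. G t + E t"])
    show "\<exists>y. ((\<lambda>t. G t + E t) has_real_derivative y) (at t) \<and> y \<le> 0" for t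
      using DERIV_add[OF G E] g_bounds(2)[of t] by (intro exI conjI) auto
  qed
  moreover have "G t - E t \<le> G t + E t" for t
  proof -
    have "0 \<le> M * exp (- a * t)" using g[of t] by linarith
    then show ?thesis using a by (simp add: E_def zero_le_mult_iff)
  qed
  ultimately obtain c where c: "\<And>t. G t - E t \<le> c" "\<And>t. c \<le> G t + E t"
    using mono_antimono_separation by blast
  then have "\<bar>c - G t\<bar> \<le> E t" for t by (simp add: abs_le_iff algebra_simps)
  then show ?thesis unfolding E_def by (rule that)
qed

text \<open>The bounded solution is \<open>exp (a t)\<close> times the tail integral of \<open>exp (- a s) F s\<close> over
  \<open>s \<ge> t\<close>, written as \<open>c - G t\<close> with \<open>c\<close> the limit of an antiderivative \<open>G\<close>.\<close>
lemma linear_ode_bounded_solution_unstable: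
  fixes F :: "real \<Rightarrow> real"
  assumes F: "continuous_on UNIV F" and M: "\<And>t. \<bar>F t\<bar> \<le> M" and a: "a > 0"
  obtains p where "\<And>t. (p has_real_derivative a * p t - F t) (at t)" "\<And>t. \<bar>p t\<bar> \<le> M / a"
proof -
  have "continuous_on UNIV (\<lambda>t. exp (- a * t) * F t)"
    by (intro continuous_intros F)
  then obtain G where G: "\<And>t. (G has_real_derivative exp (- a * t) * F t) (at t)"
    using continuous_has_antiderivative by blast
  have "\<bar>exp (- a * t) * F t\<bar> \<le> M * exp (- a * t)" for t
    using M[of t] by (simp add: abs_mult)
  then obtain c where c: "\<And>t. \<bar>c - G t\<bar> \<le> M / a * exp (- a * t)"
    using exp_decaying_derivative_limit_estimate[OF G _ a] by blast
  define p where "p t = exp (a * t) * (c - G t)" for t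
  have "(p has_real_derivative a * p t - F t) (at t)" for t
    unfolding p_def
    by (auto intro!: derivative_eq_intros G simp: algebra_simps simp flip: exp_add)
  moreover have "\<bar>p t\<bar> \<le> M / a" for t
  proof -
    have "\<bar>p t\<bar> = exp (a * t) * \<bar>c - G t\<bar>" by (simp add: p_def abs_mult)
    also have "\<dots> \<le> exp (a * t) * (M / a * exp (- a * t))"
      using c by (rule mult_left_mono) simp
    also have "\<dots> = M / a" by (simp add: exp_minus field_simps)
    finally show ?thesis .
  qed
  ultimately show ?thesis by (rule that)
qed

lemma linear_ode_bounded_solution_stable:
  fixes F :: "real \<Rightarrow> real"
  assumes F: "continuous_on UNIV F" and M: "\<And>t. \<bar>F t\<bar> \<le> M" and b: "b > 0"
  obtains z where "\<And>t. (z has_real_derivative F t - b * z t) (at t)" "\<And>t. \<bar>z t\<bar> \<le> M / b"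
proof -
  have "continuous_on UNIV (\<lambda>t. F (- t))"
    by (intro continuous_on_compose2[OF F] continuous_intros) auto
  then obtain y where y: "\<And>t. (y has_real_derivative b * y t - F (- t)) (at t)"
    and y_bound: "\<And>t. \<bar>y t\<bar> \<le> M / b"
    using linear_ode_bounded_solution_unstable M b by blast
  have "((\<lambda>t. y (- t)) has_real_derivative F t - b * y (- t)) (at t)" for t
    by (rule DERIV_cong[OF DERIV_chain2[OF y DERIV_minus[OF DERIV_ident]]]) simp
  then show ?thesis using that y_bound by blast
qed

lemma linear_ode_initial_value_solution:
  fixes p :: "real \<Rightarrow> real"
  assumes "continuous_on UNIV p"
  obtains z where "\<And>t. (z has_real_derivative p t - b * z t) (at t)" "z t0 = z0"
proof -
  have "continuous_on UNIV (\<lambda>t. exp (b * (t - t0)) * p t)"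
    by (intro continuous_intros assms)
  then obtain Q where Q: "\<And>t. (Q has_real_derivative exp (b * (t - t0)) * p t) (at t)"
    using continuous_has_antiderivative by blast
  define z where "z t = exp (- b * (t - t0)) * (z0 + Q t - Q t0)" for t
  have "(z has_real_derivative p t - b * z t) (at t)" for t
    unfolding z_def
    by (auto intro!: derivative_eq_intros Q simp: algebra_simps simp flip: exp_add)
  moreover have "z t0 = z0" by (simp add: z_def)
  ultimately show ?thesis using that by blast
qed

lemma linear_ode_exp_weighted_mono:
  fixes z p :: "real \<Rightarrow> real"
  assumes z: "\<And>t. t \<ge> c \<Longrightarrow> (z has_real_derivative p t - b * z t) (at t)"
    and p: "\<And>t. t \<ge> c \<Longrightarrow> p t \<ge> 0"
    and "c \<le> t"
  shows "exp (b * c) * z c \<le> exp (b * t) * z t"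
proof (rule deriv_nonneg_imp_mono[OF _ _ \<open>c \<le> t\<close>])
  show "((\<lambda>s. exp (b * s) * z s) has_real_derivative exp (b * s) * p s) (at s)"
    if "s \<in> {c..t}" for s
    using that by (auto intro!: derivative_eq_intros z simp: algebra_simps)
  show "0 \<le> exp (b * s) * p s" if "s \<in> {c..t}" for s using p that by simp
qed

lemma linear_ode_nonneg_if_initial_nonneg:
  fixes z p :: "real \<Rightarrow> real"
  assumes z: "\<And>t. t \<ge> c \<Longrightarrow> (z has_real_derivative p t - b * z t) (at t)"
    and p: "\<And>t. t \<ge> c \<Longrightarrow> p t \<ge> 0"
    and "z c \<ge> 0" "c \<le> t"
  shows "z t \<ge> 0"
proof -
  have "0 \<le> exp (b * c) * z c" using \<open>z c \<ge> 0\<close> by simp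
  also have "\<dots> \<le> exp (b * t) * z t" by (rule linear_ode_exp_weighted_mono[OF z p \<open>c \<le> t\<close>])
  finally show ?thesis by (simp add: zero_le_mult_iff)
qed

lemma linear_ode_nonneg_if_small_at_bot:
  fixes z p :: "real \<Rightarrow> real"
  assumes z: "\<And>t. (z has_real_derivative p t - b * z t) (at t)"
    and p: "\<And>t. p t \<ge> 0"
    and small: "z \<in> o[at_bot](\<lambda>t. exp (- b * t))"
  shows "z t \<ge> 0"
proof -
  have "((\<lambda>s. exp (b * s) * z s) \<longlongrightarrow> 0) at_bot"
    using smalloD_tendsto[OF small] by (simp add: exp_minus field_simps)
  moreover have "eventually (\<lambda>s. exp (b * s) * z s \<le> exp (b * t) * z t) at_bot"
    unfolding eventually_at_bot_linorder using linear_ode_exp_weighted_mono[OF z p] by blast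
  ultimately have "0 \<le> exp (b * t) * z t"
    using tendsto_upperbound by fastforce
  then show ?thesis by (simp add: zero_le_mult_iff)
qed

lemma linear_ode_nonneg_if_small_at_top:
  fixes p F :: "real \<Rightarrow> real"
  assumes p: "\<And>t. t \<ge> c \<Longrightarrow> (p has_real_derivative a * p t - F t) (at t)"
    and F: "\<And>t. t \<ge> c \<Longrightarrow> F t \<ge> 0"
    and small: "p \<in> o(\<lambda>t. exp (a * t))"
  shows "p c \<ge> 0"
proof -
  have "((\<lambda>t. exp (- a * t) * p t) \<longlongrightarrow> 0) at_top"
    using smalloD_tendsto[OF small] by (simp add: exp_minus field_simps)
  moreover have "exp (- a * t) * p t \<le> exp (- a * c) * p c" if "c \<le> t" for t
  proof -
    have "exp (- a * c) * - p c \<le> exp (- a * t) * - p t"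
      by (rule linear_ode_exp_weighted_mono[of c "\<lambda>t. - p t" F "- a", OF _ F that])
         (auto intro!: derivative_eq_intros p)
    then show ?thesis by simp
  qed
  then have "eventually (\<lambda>t. exp (- a * t) * p t \<le> exp (- a * c) * p c) at_top"
    unfolding eventually_at_top_linorder by blast
  ultimately have "0 \<le> exp (- a * c) * p c"
    using tendsto_upperbound by fastforce
  then show ?thesis by (simp add: zero_le_mult_iff)
qed

lemma linear_ode_tendsto_0:
  fixes z p :: "real \<Rightarrow> real"
  assumes z: "eventually (\<lambda>t. (z has_real_derivative p t - b * z t) (at t)) at_top"
    and p: "(p \<longlongrightarrow> 0) at_top" and b: "b > 0"
  shows "(z \<longlongrightarrow> 0) at_top"
proof -
  have "((\<lambda>t. (exp (b * t) * z t) / exp (b * t)) \<longlongrightarrow> 0) at_top"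
  proof (rule lhospital_at_top_at_top)
    show "LIM t at_top. exp (b * t) :> at_top"
      using b by real_asymp
    show "\<forall>\<^sub>F t in at_top. b * exp (b * t) \<noteq> 0" using b by simp
    show "\<forall>\<^sub>F t in at_top. ((\<lambda>t. exp (b * t) * z t) has_real_derivative exp (b * t) * p t) (at t)"
      using z by eventually_elim (auto intro!: derivative_eq_intros simp: algebra_simps)
    show "\<forall>\<^sub>F t in at_top. ((\<lambda>t. exp (b * t)) has_real_derivative b * exp (b * t)) (at t)"
      by (intro always_eventually allI) (auto intro!: derivative_eq_intros)
    show "((\<lambda>t. exp (b * t) * p t / (b * exp (b * t))) \<longlongrightarrow> 0) at_top"
      using tendsto_divide_zero[OF p, of b] by simp
  qed
  then show ?thesis by simp
qed

section \<open>The factored second-order operator\<close>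

lemma exp_smallo_exp_at_top:
  fixes a c :: real
  assumes "c < a"
  shows "(\<lambda>t. exp (c * t)) \<in> o(\<lambda>t. exp (a * t))"
proof (rule smalloI_tendsto)
  have "((\<lambda>t. exp (- d * t)) \<longlongrightarrow> 0) at_top" if "d > 0" for d :: real
    using that by real_asymp
  from this[of "a - c"] show "((\<lambda>t. exp (c * t) / exp (a * t)) \<longlongrightarrow> 0) at_top"
    using assms by (simp add: algebra_simps flip: exp_diff)
qed simp

lemma exp_smallo_exp_at_bot:
  fixes a c :: real
  assumes "a < c"
  shows "(\<lambda>t. exp (c * t)) \<in> o[at_bot](\<lambda>t. exp (a * t))"
  using exp_smallo_exp_at_top[of "- c" "- a"] assms
  by (simp add: at_bot_mirror landau_o.small.in_filtermap_iff)

text \<open>Eliminating the inner function \<open>p\<close> gives \<open>- z'' + (a - b) z' + a b z = F\<close>. The growth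
  condition on \<open>p\<close> removes the solution \<open>exp (a t)\<close> of the homogeneous equation.\<close>
definition factored_solution ::
    "real set \<Rightarrow> real \<Rightarrow> real \<Rightarrow> (real \<Rightarrow> real) \<Rightarrow> (real \<Rightarrow> real) \<Rightarrow> (real \<Rightarrow> real) \<Rightarrow> bool" where
  "factored_solution I a b F p z \<longleftrightarrow>
     (\<forall>t\<in>I. (p has_real_derivative a * p t - F t) (at t)
           \<and> (z has_real_derivative p t - b * z t) (at t))
     \<and> p \<in> o(\<lambda>t. exp (a * t))"

lemma factored_solutionD:
  assumes "factored_solution I a b F p z"
  shows "t \<in> I \<Longrightarrow> (p has_real_derivative a * p t - F t) (at t)"
    and "t \<in> I \<Longrightarrow> (z has_real_derivative p t - b * z t) (at t)"
    and "p \<in> o(\<lambda>t. exp (a * t))"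
  using assms by (auto simp: factored_solution_def)

lemma factored_solution_if_inner_bigo_1:
  assumes "\<And>t. t \<in> I \<Longrightarrow> (p has_real_derivative a * p t - F t) (at t)"
    and "\<And>t. t \<in> I \<Longrightarrow> (z has_real_derivative p t - b * z t) (at t)"
    and "p \<in> O(\<lambda>_. 1)" "a > 0"
  shows "factored_solution I a b F p z"
proof -
  have "(\<lambda>_. 1) \<in> o(\<lambda>t. exp (a * t))" using exp_smallo_exp_at_top[OF \<open>a > 0\<close>] by simp
  with \<open>p \<in> O(\<lambda>_. 1)\<close> have "p \<in> o(\<lambda>t. exp (a * t))" by (rule landau_o.big_small_trans)
  then show ?thesis using assms(1,2) by (simp add: factored_solution_def)
qed

lemma factored_solution_continuous_on:
  assumes "factored_solution I a b F p z"
  shows "continuous_on I p" "continuous_on I z"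
  using factored_solutionD(1,2)[OF assms]
  by (meson DERIV_isCont continuous_at_imp_continuous_on)+

lemma factored_solution_diff:
  assumes "factored_solution I a b F p z" "factored_solution I a b G q y"
  shows "factored_solution I a b (\<lambda>t. F t - G t) (\<lambda>t. p t - q t) (\<lambda>t. z t - y t)"
  using sum_in_smallo(2)[OF assms[THEN factored_solutionD(3)]] unfolding factored_solution_def
  by (auto intro!: derivative_eq_intros assms[THEN factored_solutionD(1)]
      assms[THEN factored_solutionD(2)] simp: algebra_simps)

lemma factored_solution_exp:
  assumes "c < a"
  shows "factored_solution I a b (\<lambda>t. (a - c) * (b + c) * C * exp (c * t))
    (\<lambda>t. (b + c) * C * exp (c * t)) (\<lambda>t. C * exp (c * t))"
proof -
  have "(\<lambda>t. exp (c * t)) \<in> o(\<lambda>t. exp (a * t))" using assms by (rule exp_smallo_exp_at_top)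
  then have "(\<lambda>t. (b + c) * C * exp (c * t)) \<in> o(\<lambda>t. exp (a * t))" by simp
  then show ?thesis
    unfolding factored_solution_def by (auto intro!: derivative_eq_intros simp: algebra_simps)
qed

lemma factored_solution_const:
  assumes "a > 0" "b \<noteq> 0"
  shows "factored_solution I a b (\<lambda>t. d) (\<lambda>t. d / a) (\<lambda>t. d / (a * b))"
  using factored_solution_exp[of 0 a I b "d / (a * b)"] assms by simp

lemma factored_solution_inner_mono:
  assumes p: "factored_solution I a b F p z" and q: "factored_solution I a b G q y"
    and "{t..} \<subseteq> I" "\<And>s. t \<le> s \<Longrightarrow> F s \<le> G s"
  shows "p t \<le> q t"
proof -
  note d = factored_solution_diff[OF q p]
  have "0 \<le> q t - p t"
    by (rule linear_ode_nonneg_if_small_at_top[OF factored_solutionD(1)[OF d] _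
          factored_solutionD(3)[OF d]])
       (use assms(3,4) in auto)
  then show ?thesis by simp
qed

lemma factored_solution_mono_half_line:
  assumes z: "factored_solution {0..} a b F p z" and y: "factored_solution {0..} a b G q y"
    and FG: "\<And>t. 0 \<le> t \<Longrightarrow> F t \<le> G t"
    and "0 \<le> \<gamma>" "z 0 - \<gamma> * p 0 \<le> y 0 - \<gamma> * q 0" and t: "0 \<le> t"
  shows "z t \<le> y t"
proof -
  note d = factored_solution_diff[OF y z]
  have pq: "p s \<le> q s" if "0 \<le> s" for s
    by (rule factored_solution_inner_mono[OF z y]) (use FG that in auto)
  have "0 \<le> \<gamma> * (q 0 - p 0)" using pq[of 0] \<open>0 \<le> \<gamma>\<close> by simp
  then have "0 \<le> y 0 - z 0" using assms(5) by (simp add: algebra_simps)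
  then have "0 \<le> y t - z t"
    by (intro linear_ode_nonneg_if_initial_nonneg[OF factored_solutionD(2)[OF d] _ _ t])
       (use pq in auto)
  then show ?thesis by simp
qed

lemma factored_solution_mono_line:
  assumes z: "factored_solution UNIV a b F p z" "z \<in> o[at_bot](\<lambda>t. exp (- b * t))"
    and y: "factored_solution UNIV a b G q y" "y \<in> o[at_bot](\<lambda>t. exp (- b * t))"
    and FG: "\<And>t. F t \<le> G t"
  shows "z t \<le> y t"
proof -
  note d = factored_solution_diff[OF y(1) z(1)]
  have "p s \<le> q s" for s
    by (rule factored_solution_inner_mono[OF z(1) y(1)]) (use FG in auto)
  then have "0 \<le> y t - z t"
    by (intro linear_ode_nonneg_if_small_at_bot[OF factored_solutionD(2)[OF d]]
        sum_in_smallo y z) auto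
  then show ?thesis by simp
qed

lemma factored_solution_inner_bound:
  assumes p: "factored_solution I a b F p z" and "{c..} \<subseteq> I" and ab: "a > 0" "b \<noteq> 0"
    and F: "\<And>t. t \<ge> c \<Longrightarrow> \<bar>F t\<bar> \<le> d" and "t \<ge> c"
  shows "\<bar>p t\<bar> \<le> d / a"
proof -
  have I: "{t..} \<subseteq> I" using assms(2) \<open>t \<ge> c\<close> by auto
  have F': "- d \<le> F s" "F s \<le> d" if "t \<le> s" for s
    using F[of s] \<open>t \<ge> c\<close> that by (auto simp: abs_le_iff)
  note const = factored_solution_const[OF ab, of I]
  have "p t \<le> d / a"
    by (rule factored_solution_inner_mono[OF p const I F'(2)])
  moreover have "- d / a \<le> p t"
    by (rule factored_solution_inner_mono[OF const p I F'(1)])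
  ultimately show ?thesis by (simp add: abs_le_iff)
qed

lemma factored_solution_inner_bigo_1:
  assumes p: "factored_solution I a b F p z" and I: "{c..} \<subseteq> I" and ab: "a > 0" "b \<noteq> 0"
    and F: "F \<in> O(\<lambda>_. 1)"
  shows "p \<in> O(\<lambda>_. 1)"
proof -
  obtain d where "eventually (\<lambda>t. \<bar>F t\<bar> \<le> d) at_top"
    using F by (auto elim!: landau_o.bigE)
  then obtain c' where "\<And>t. t \<ge> c' \<Longrightarrow> \<bar>F t\<bar> \<le> d"
    by (auto simp: eventually_at_top_linorder)
  then have "\<bar>p t\<bar> \<le> d / a" if "t \<ge> max c c'" for t
    by (intro factored_solution_inner_bound[OF p _ ab _ that]) (use I in auto)
  then have "eventually (\<lambda>t. \<bar>p t\<bar> \<le> d / a) at_top"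
    unfolding eventually_at_top_linorder by blast
  then show ?thesis by (intro bigoI[where c = "d / a"]) simp
qed

lemma factored_solution_inner_tendsto_0:
  assumes p: "factored_solution I a b F p z" and I: "{c..} \<subseteq> I" and ab: "a > 0" "b \<noteq> 0"
    and F: "(F \<longlongrightarrow> 0) at_top"
  shows "(p \<longlongrightarrow> 0) at_top"
proof (rule tendstoI)
  fix e :: real assume "e > 0"
  then have "eventually (\<lambda>t. \<bar>F t\<bar> < a * e / 2) at_top"
    using tendstoD[OF F, of "a * e / 2"] ab by (simp add: dist_real_def)
  then obtain c' where "\<And>t. t \<ge> c' \<Longrightarrow> \<bar>F t\<bar> < a * e / 2"
    by (auto simp: eventually_at_top_linorder)
  then have "\<bar>p t\<bar> \<le> a * e / 2 / a" if "t \<ge> max c c'" for t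
    by (intro factored_solution_inner_bound[OF p _ ab _ that]) (use I in \<open>auto simp: less_imp_le\<close>)
  moreover have "a * e / 2 / a < e" using ab \<open>e > 0\<close> by simp
  ultimately have "dist (p t) 0 < e" if "t \<ge> max c c'" for t
    using that by (fastforce simp: dist_real_def)
  then show "eventually (\<lambda>t. dist (p t) 0 < e) at_top"
    unfolding eventually_at_top_linorder by blast
qed

lemma factored_solution_tendsto_0:
  assumes z: "factored_solution I a b F p z" and I: "{c..} \<subseteq> I" and ab: "a > 0" "b > 0"
    and F: "(F \<longlongrightarrow> 0) at_top"
  shows "(z \<longlongrightarrow> 0) at_top"
proof (rule linear_ode_tendsto_0)
  show "(p \<longlongrightarrow> 0) at_top"
    using factored_solution_inner_tendsto_0[OF z I \<open>a > 0\<close> _ F] \<open>b > 0\<close> by simp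
  show "eventually (\<lambda>t. (z has_real_derivative p t - b * z t) (at t)) at_top"
    using eventually_ge_at_top[of c] by eventually_elim (use factored_solutionD(2)[OF z] I in auto)
qed (rule ab)

lemma factored_solution_unshift:
  assumes z: "factored_solution I (a + k) (b + k) F p z" and I: "{c..} \<subseteq> I"
    and ab: "a > 0" "b > 0" and k: "k \<ge> 0"
    and F: "F \<in> O(\<lambda>_. 1)" and "z \<in> O(\<lambda>_. 1)"
    and eq: "\<And>t. t \<in> I \<Longrightarrow> F t = G t + k * (a + b + k) * z t"
  shows "factored_solution I a b G (\<lambda>t. p t - k * z t) z"
proof (rule factored_solution_if_inner_bigo_1)
  show z': "(z has_real_derivative p t - k * z t - b * z t) (at t)" if "t \<in> I" for t
    using factored_solutionD(2)[OF z that] by (simp add: algebra_simps)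
  show "((\<lambda>t. p t - k * z t) has_real_derivative a * (p t - k * z t) - G t) (at t)" if "t \<in> I" for t
    using that
    by (auto intro!: derivative_eq_intros factored_solutionD(1)[OF z] z' simp: eq algebra_simps)
  have "p \<in> O(\<lambda>_. 1)"
    using factored_solution_inner_bigo_1[OF z I _ _ F] ab k by simp
  then show "(\<lambda>t. p t - k * z t) \<in> O(\<lambda>_. 1)"
    using \<open>z \<in> O(\<lambda>_. 1)\<close> by (intro sum_in_bigo) auto
qed (rule ab)

section \<open>Fixed points between zero and a supersolution\<close>

locale solver_with_comparison =
  fixes Sol :: "('a::metric_space \<Rightarrow> real) \<Rightarrow> ('a \<Rightarrow> real) \<Rightarrow> bool" and \<mu> :: real
  assumes solvable: "continuous_on UNIV F \<Longrightarrow> bounded (range F) \<Longrightarrow> \<exists>z. Sol F z"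
    and solution_continuous: "Sol F z \<Longrightarrow> continuous_on UNIV z"
    and zero_solution: "Sol (\<lambda>t. 0) (\<lambda>t. 0)"
    and comparison: "Sol F z \<Longrightarrow> Sol G y \<Longrightarrow> (\<And>t. F t - G t \<le> d) \<Longrightarrow> 0 \<le> d \<Longrightarrow> z t - y t \<le> d / \<mu>"
begin

lemma solution_nonneg: "Sol F z \<Longrightarrow> (\<And>t. 0 \<le> F t) \<Longrightarrow> 0 \<le> z t"
  using comparison[OF zero_solution, of F z 0 t] by simp

lemma solution_le: "Sol F z \<Longrightarrow> (\<And>t. F t \<le> d) \<Longrightarrow> 0 \<le> d \<Longrightarrow> z t \<le> d / \<mu>"
  using comparison[OF _ zero_solution, of F z d t] by simp

lemma solution_dist_le:
  assumes "Sol F z" "Sol G y" "\<And>t. \<bar>F t - G t\<bar> \<le> d"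
  shows "\<bar>z t - y t\<bar> \<le> d / \<mu>"
proof -
  have "0 \<le> d" using assms(3)[of undefined] by linarith
  have "F t - G t \<le> d" "G t - F t \<le> d" for t
    using assms(3)[of t] by linarith+
  then have "z t - y t \<le> d / \<mu>" "y t - z t \<le> d / \<mu>"
    using comparison assms(1,2) \<open>0 \<le> d\<close> by blast+
  then show ?thesis by linarith
qed

lemma bounded_nonneg_solution:
  assumes "continuous_on UNIV F" "\<And>t. 0 \<le> F t" "\<And>t. F t \<le> B"
  obtains x where "Sol F (apply_bcontfun x)" "\<And>t. 0 \<le> apply_bcontfun x t"
proof -
  have "bounded (range F)"
    using assms(2,3) by (auto simp: bounded_iff intro!: exI[of _ B])
  then obtain z where z: "Sol F z" using solvable assms(1) by blast
  have "0 \<le> B" using assms(2,3) order_trans by blast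
  then have z_bounds: "0 \<le> z t" "z t \<le> B / \<mu>" for t
    using solution_nonneg[OF z assms(2)] solution_le[OF z assms(3)] by auto
  then have "z \<in> bcontfun"
    using solution_continuous[OF z] z_bounds
    by (auto simp: bcontfun_def bounded_iff intro!: exI[of _ "B / \<mu>"])
  then obtain x where "z = apply_bcontfun x" by (rule bcontfunE)
  then show ?thesis using that[of x] z z_bounds(1) by simp
qed

lemma contraction_fixed_point:
  fixes \<Psi> :: "('a \<Rightarrow>\<^sub>C real) \<Rightarrow> 'a \<Rightarrow> real"
  assumes "closed S" "S \<noteq> {}"
    and invariant: "\<And>y. y \<in> S \<Longrightarrow> \<exists>x\<in>S. Sol (\<Psi> y) (apply_bcontfun x)"
    and lipschitz: "\<And>y x t. y \<in> S \<Longrightarrow> x \<in> S \<Longrightarrow> \<bar>\<Psi> y t - \<Psi> x t\<bar> \<le> K * dist y x"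
    and K: "0 \<le> K" "K < \<mu>"
  obtains y where "y \<in> S" "Sol (\<Psi> y) (apply_bcontfun y)"
proof -
  obtain T where T: "\<And>y. y \<in> S \<Longrightarrow> T y \<in> S \<and> Sol (\<Psi> y) (apply_bcontfun (T y))"
    using invariant by metis
  have "dist (T y) (T x) \<le> K / \<mu> * dist y x" if "y \<in> S" "x \<in> S" for y x
    using solution_dist_le[of "\<Psi> y" "T y" "\<Psi> x" "T x" "K * dist y x"] lipschitz T that
    by (auto intro!: dist_bound simp: dist_real_def)
  moreover have "complete S" using \<open>closed S\<close> by (simp add: complete_eq_closed)
  ultimately obtain y where "y \<in> S" "T y = y"
    using Banach_fix[of S "K / \<mu>" T] \<open>S \<noteq> {}\<close> T K by (auto simp: divide_less_eq)
  then show ?thesis using that T by metis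
qed

lemma monotone_fixed_point:
  fixes \<Phi> :: "'a \<Rightarrow> real \<Rightarrow> real" and \<rho> :: "'a \<Rightarrow> real"
  assumes cont: "\<And>y. continuous_on UNIV y \<Longrightarrow> continuous_on UNIV (\<lambda>t. \<Phi> t (y t))"
    and at_0: "\<And>t. 0 \<le> \<Phi> t 0" "\<And>t. \<Phi> t 0 \<le> M"
    and incr: "\<And>t x y. 0 \<le> x \<Longrightarrow> x \<le> y \<Longrightarrow> y \<le> \<rho> t \<Longrightarrow>
      0 \<le> \<Phi> t y - \<Phi> t x \<and> \<Phi> t y - \<Phi> t x \<le> K * (y - x)"
    and K: "0 \<le> K" "K < \<mu>"
    and \<rho>: "\<And>t. 0 \<le> \<rho> t"
    and super: "\<And>F z t. Sol F z \<Longrightarrow> (\<And>s. F s \<le> \<Phi> s (\<rho> s)) \<Longrightarrow> z t \<le> \<rho> t"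
  obtains y where "Sol (\<lambda>t. \<Phi> t (y t)) y" "\<And>t. 0 \<le> y t" "\<And>t. y t \<le> \<rho> t" "bounded (range y)"
proof -
  define S :: "('a \<Rightarrow>\<^sub>C real) set" where "S = PiC UNIV (\<lambda>t. {0..\<rho> t})"
  have S_iff: "y \<in> S \<longleftrightarrow> (\<forall>t. 0 \<le> y t \<and> y t \<le> \<rho> t)" for y
    by (auto simp: S_def mem_PiC_iff)
  have "closed S" unfolding S_def by (rule closed_PiC) simp
  moreover have "const_bcontfun 0 \<in> S"
    using \<rho> by (simp add: S_iff const_bcontfun.rep_eq)
  moreover have "\<exists>x\<in>S. Sol (\<lambda>t. \<Phi> t (y t)) (apply_bcontfun x)" if "y \<in> S" for y
  proof -
    have y: "0 \<le> y t" "y t \<le> \<rho> t" for t using that by (auto simp: S_iff)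
    have nonneg: "0 \<le> \<Phi> t (y t)" for t
      using at_0(1)[of t] incr[of 0 "y t" t] y[of t] by simp
    obtain B where B: "\<And>t. \<bar>y t\<bar> \<le> B"
      using bounded_apply_bcontfun[of y] by (auto simp: bounded_iff)
    have "\<Phi> t (y t) \<le> M + K * B" for t
    proof -
      have "K * y t \<le> K * B" using B[of t] K(1) by (intro mult_left_mono) auto
      then show ?thesis using at_0(2)[of t] incr[of 0 "y t" t] y[of t] by simp
    qed
    then obtain x where x: "Sol (\<lambda>t. \<Phi> t (y t)) (apply_bcontfun x)" "\<And>t. 0 \<le> x t"
      using bounded_nonneg_solution[OF cont[OF continuous_on_apply_bcontfun] nonneg] by blast
    moreover have "x t \<le> \<rho> t" for t using incr y by (intro super[OF x(1)]) simp
    ultimately show ?thesis by (auto simp: S_iff)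
  qed
  moreover have "\<bar>\<Phi> t (y t) - \<Phi> t (x t)\<bar> \<le> K * dist y x" if "y \<in> S" "x \<in> S" for y x t
  proof -
    have "\<bar>\<Phi> t (y t) - \<Phi> t (x t)\<bar> \<le> K * \<bar>y t - x t\<bar>"
      using incr[of "x t" "y t" t] incr[of "y t" "x t" t] that by (auto simp: S_iff abs_if)
    also have "\<dots> \<le> K * dist y x"
      using dist_bounded[of y t x] K(1) by (intro mult_left_mono) (auto simp: dist_real_def)
    finally show ?thesis .
  qed
  ultimately obtain y where "y \<in> S" "Sol (\<lambda>t. \<Phi> t (y t)) (apply_bcontfun y)"
    using contraction_fixed_point[of S "\<lambda>y t. \<Phi> t (y t)" K] K by blast
  then show ?thesis using that[of y] by (simp add: S_iff)
qed

lemma quadratic_fixed_point: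
  fixes f q \<rho> :: "'a \<Rightarrow> real"
  assumes f: "continuous_on UNIV f" "\<And>t. 0 \<le> f t" "\<And>t. f t \<le> M"
    and q: "continuous_on UNIV q" "\<And>t. 0 \<le> q t" "\<And>t. 2 * (q t * \<rho> t) \<le> K"
    and "0 \<le> K" "K < \<mu>"
    and \<rho>: "\<And>t. 0 \<le> \<rho> t"
    and super: "\<And>F z t. Sol F z \<Longrightarrow> (\<And>s. F s \<le> f s + K * \<rho> s) \<Longrightarrow> z t \<le> \<rho> t"
  obtains y where "Sol (\<lambda>t. f t + K * y t - q t * (y t)\<^sup>2) y"
    "\<And>t. 0 \<le> y t" "\<And>t. y t \<le> \<rho> t" "bounded (range y)"
proof (rule monotone_fixed_point[where \<Phi> = "\<lambda>t y. f t + K * y - q t * y\<^sup>2"])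
  fix t x y assume xy: "0 \<le> x" "x \<le> y" "y \<le> \<rho> t"
  have "q t * (x + y) \<le> q t * (2 * \<rho> t)"
    using xy q(2) by (intro mult_left_mono) auto
  then have slope: "0 \<le> K - q t * (x + y)" "K - q t * (x + y) \<le> K"
    using q(2,3)[of t] xy by auto
  have "f t + K * y - q t * y\<^sup>2 - (f t + K * x - q t * x\<^sup>2) = (K - q t * (x + y)) * (y - x)"
    by (simp add: power2_eq_square algebra_simps)
  then show "0 \<le> f t + K * y - q t * y\<^sup>2 - (f t + K * x - q t * x\<^sup>2) \<and>
      f t + K * y - q t * y\<^sup>2 - (f t + K * x - q t * x\<^sup>2) \<le> K * (y - x)"
    using xy(2) slope by (simp only:) (auto intro!: mult_right_mono mult_nonneg_nonneg)
next
  fix F z t assume z: "Sol F z" and F: "\<And>s. F s \<le> f s + K * \<rho> s - q s * (\<rho> s)\<^sup>2"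
  show "z t \<le> \<rho> t"
  proof (rule super[OF z])
    show "F s \<le> f s + K * \<rho> s" for s
      using F[of s] mult_nonneg_nonneg[OF q(2)[of s] zero_le_power2[of "\<rho> s"]] by linarith
  qed
qed (use assms that in \<open>auto intro!: continuous_intros\<close>)

end

section \<open>The boundary value problems on the half-line and on the line\<close>

text \<open>Extending half-line solutions to the left by a constant lets both problems live in the space
  of bounded continuous functions on \<open>\<real>\<close>.\<close>
definition half_line_solution ::
    "real \<Rightarrow> real \<Rightarrow> real \<Rightarrow> (real \<Rightarrow> real) \<Rightarrow> (real \<Rightarrow> real) \<Rightarrow> bool" where
  "half_line_solution a b \<gamma> F z \<longleftrightarrow>
     (\<exists>p y. factored_solution {0..} a b F p y \<and> y 0 = \<gamma> * p 0 \<and> z = (\<lambda>t. y (max 0 t)))"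

definition line_solution :: "real \<Rightarrow> real \<Rightarrow> (real \<Rightarrow> real) \<Rightarrow> (real \<Rightarrow> real) \<Rightarrow> bool" where
  "line_solution a b F z \<longleftrightarrow>
     (\<exists>p. factored_solution UNIV a b F p z) \<and> z \<in> o[at_bot](\<lambda>t. exp (- b * t))"

lemma bounded_range_imp_bigo_1:
  fixes f :: "'a \<Rightarrow> real"
  assumes "bounded (range f)"
  shows "f \<in> O[F](\<lambda>_. 1)"
proof -
  obtain B where "\<And>t. \<bar>f t\<bar> \<le> B" using assms by (auto simp: bounded_iff)
  then show ?thesis by (intro bigoI[where c = B]) simp
qed

lemma bounded_inner_function_exists:
  assumes F: "continuous_on UNIV F" "bounded (range F)" and a: "a > 0"
  obtains p where "\<And>t. (p has_real_derivative a * p t - F t) (at t)"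
    "continuous_on UNIV p" "bounded (range p)"
proof -
  obtain M where "\<And>t. \<bar>F t\<bar> \<le> M" using F(2) by (auto simp: bounded_iff)
  then obtain p where p: "\<And>t. (p has_real_derivative a * p t - F t) (at t)" "\<And>t. \<bar>p t\<bar> \<le> M / a"
    using linear_ode_bounded_solution_unstable F(1) a by blast
  show ?thesis
  proof
    show "continuous_on UNIV p"
      using p(1) by (auto intro!: continuous_at_imp_continuous_on DERIV_isCont)
    show "bounded (range p)" using p(2) by (auto simp: bounded_iff)
  qed (rule p(1))
qed

lemma half_line_solution_exists:
  assumes "continuous_on UNIV F" "bounded (range F)" and "a > 0"
  shows "\<exists>z. half_line_solution a b \<gamma> F z"
proof -
  obtain p where p: "\<And>t. (p has_real_derivative a * p t - F t) (at t)"
      "continuous_on UNIV p" "bounded (range p)"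
    by (rule bounded_inner_function_exists[OF assms]) (rule that)
  obtain y where y: "\<And>t. (y has_real_derivative p t - b * y t) (at t)" "y 0 = \<gamma> * p 0"
    by (rule linear_ode_initial_value_solution[OF p(2)]) (rule that)
  have "factored_solution {0..} a b F p y"
    using p(1) y(1) bounded_range_imp_bigo_1[OF p(3)] \<open>a > 0\<close>
    by (rule factored_solution_if_inner_bigo_1)
  then show ?thesis using y(2) by (auto simp: half_line_solution_def)
qed

lemma line_solution_exists:
  assumes F: "continuous_on UNIV F" "bounded (range F)" and ab: "a > 0" "b > 0"
  shows "\<exists>z. line_solution a b F z"
proof -
  obtain p where p: "\<And>t. (p has_real_derivative a * p t - F t) (at t)"
      "continuous_on UNIV p" "bounded (range p)"
    by (rule bounded_inner_function_exists[OF F ab(1)]) (rule that)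
  obtain M where M: "\<And>t. \<bar>p t\<bar> \<le> M" using p(3) by (auto simp: bounded_iff)
  obtain z where z: "\<And>t. (z has_real_derivative p t - b * z t) (at t)" "\<And>t. \<bar>z t\<bar> \<le> M / b"
    by (rule linear_ode_bounded_solution_stable[OF p(2) M ab(2)]) (rule that)
  have "factored_solution UNIV a b F p z"
    using p(1) z(1) bounded_range_imp_bigo_1[OF p(3)] ab(1)
    by (rule factored_solution_if_inner_bigo_1)
  moreover have "bounded (range z)" using z(2) by (auto simp: bounded_iff)
  then have "z \<in> o[at_bot](\<lambda>t. exp (- b * t))"
    by (rule landau_o.big_small_trans[OF bounded_range_imp_bigo_1])
       (use exp_smallo_exp_at_bot[of "- b" 0] ab(2) in simp)
  ultimately show ?thesis by (auto simp: line_solution_def)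
qed

lemma half_line_solution_diff_le:
  assumes ab: "a > 0" "b > 0" and \<gamma>: "0 \<le> \<gamma>" "\<gamma> * b \<le> 1"
    and z: "half_line_solution a b \<gamma> F z" and y: "half_line_solution a b \<gamma> G y"
    and d: "\<And>t. F t - G t \<le> d" "0 \<le> d"
  shows "z t - y t \<le> d / (a * b)"
proof -
  obtain p z' where z': "factored_solution {0..} a b F p z'" "z' 0 = \<gamma> * p 0"
      and z_eq: "z = (\<lambda>t. z' (max 0 t))"
    using z by (auto simp: half_line_solution_def)
  obtain q y' where y': "factored_solution {0..} a b G q y'" "y' 0 = \<gamma> * q 0"
      and y_eq: "y = (\<lambda>t. y' (max 0 t))"
    using y by (auto simp: half_line_solution_def)
  have "\<gamma> * b * (d / (a * b)) \<le> 1 * (d / (a * b))"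
    using \<gamma>(2) d(2) ab by (intro mult_right_mono) auto
  then have "\<gamma> * (d / a) \<le> d / (a * b)" using ab by simp
  then have boundary: "z' 0 - y' 0 - \<gamma> * (p 0 - q 0) \<le> d / (a * b) - \<gamma> * (d / a)"
    using z'(2) y'(2) by (simp add: algebra_simps)
  have "z' (max 0 t) - y' (max 0 t) \<le> d / (a * b)"
    by (rule factored_solution_mono_half_line[OF factored_solution_diff[OF z'(1) y'(1)]
          factored_solution_const _ \<gamma>(1) boundary]) (use ab d in auto)
  then show ?thesis by (simp add: z_eq y_eq)
qed

lemma line_solution_diff_le:
  assumes ab: "a > 0" "b > 0"
    and z: "line_solution a b F z" and y: "line_solution a b G y" and d: "\<And>t. F t - G t \<le> d"
  shows "z t - y t \<le> d / (a * b)"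
proof -
  obtain p q where "factored_solution UNIV a b F p z" "factored_solution UNIV a b G q y"
    using y z by (auto simp: line_solution_def)
  note diff = factored_solution_diff[OF this]
  have "(\<lambda>_. d / (a * b)) \<in> o[at_bot](\<lambda>t. exp (- b * t))"
    by (rule landau_o.big_small_trans[of _ _ "\<lambda>_. 1"])
       (use exp_smallo_exp_at_bot[of "- b" 0] ab(2) in simp_all)
  then show ?thesis
    using z y ab d unfolding line_solution_def
    by (intro factored_solution_mono_line[OF diff _ factored_solution_const] sum_in_smallo) auto
qed

lemma half_line_solver:
  assumes ab: "a > 0" "b > 0" and "0 \<le> \<gamma>" "\<gamma> * b \<le> 1"
  shows "solver_with_comparison (half_line_solution a b \<gamma>) (a * b)"
proof
  show "continuous_on UNIV z" if z: "half_line_solution a b \<gamma> F z" for F z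
  proof -
    obtain p y where y: "factored_solution {0..} a b F p y" and z_eq: "z = (\<lambda>t. y (max 0 t))"
      using z by (auto simp: half_line_solution_def)
    have "continuous_on UNIV (max 0 :: real \<Rightarrow> real)" by (intro continuous_intros)
    then show ?thesis
      unfolding z_eq
      by (rule continuous_on_compose2[OF factored_solution_continuous_on(2)[OF y]]) auto
  qed
  show "half_line_solution a b \<gamma> (\<lambda>t. 0) (\<lambda>t. 0)"
    unfolding half_line_solution_def
    using factored_solution_const[of a b "{0..}" 0] ab by (intro exI[of _ "\<lambda>t. 0"]) auto
  show "\<exists>z. half_line_solution a b \<gamma> F z" if "continuous_on UNIV F" "bounded (range F)" for F
    by (rule half_line_solution_exists[OF that ab(1)])
  show "z t - y t \<le> d / (a * b)"
    if "half_line_solution a b \<gamma> F z" "half_line_solution a b \<gamma> G y" "\<And>t. F t - G t \<le> d" "0 \<le> d"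
    for F z G y d t
    by (rule half_line_solution_diff_le[OF assms that])
qed

lemma line_solver:
  assumes ab: "a > 0" "b > 0"
  shows "solver_with_comparison (line_solution a b) (a * b)"
proof
  show "continuous_on UNIV z" if "line_solution a b F z" for F z
    using that factored_solution_continuous_on(2) by (auto simp: line_solution_def)
  show "line_solution a b (\<lambda>t. 0) (\<lambda>t. 0)"
    using factored_solution_const[of a b UNIV 0] ab by (auto simp: line_solution_def)
  show "\<exists>z. line_solution a b F z" if "continuous_on UNIV F" "bounded (range F)" for F
    by (rule line_solution_exists[OF that ab])
  show "z t - y t \<le> d / (a * b)"
    if "line_solution a b F z" "line_solution a b G y" "\<And>t. F t - G t \<le> d" for F z G y d t
    by (rule line_solution_diff_le[OF ab that])
qed

lemma continuous_on_line_bounded: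
  fixes f :: "real \<Rightarrow> real"
  assumes "continuous_on UNIV f" "(f \<longlongrightarrow> l) at_top" "(f \<longlongrightarrow> l') at_bot"
  shows "bounded (range f)"
proof (rule continuous_bounded_at_infinity_imp_bounded)
  show "f \<in> O[at_bot](\<lambda>_. 1)" using assms(3) by (intro bigoI_tendsto[where c = l']) auto
  show "f \<in> O(\<lambda>_. 1)" using assms(2) by (intro bigoI_tendsto[where c = l]) auto
qed (rule assms)

lemma continuous_on_half_line_bounded:
  fixes f :: "real \<Rightarrow> real"
  assumes f: "continuous_on {c..} f" and lim: "(f \<longlongrightarrow> l) at_top"
  shows "bounded (f ` {c..})"
proof -
  define g where "g t = f (max c t)" for t
  have "eventually (\<lambda>t. f c = g t) at_bot"
    using eventually_le_at_bot[of c] by eventually_elim (simp add: g_def max_def)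
  then have at_bot: "(g \<longlongrightarrow> f c) at_bot" by (rule Lim_transform_eventually[OF tendsto_const])
  have "eventually (\<lambda>t. f t = g t) at_top"
    using eventually_ge_at_top[of c] by eventually_elim (simp add: g_def max_def)
  then have at_top: "(g \<longlongrightarrow> l) at_top" by (rule Lim_transform_eventually[OF lim])
  have "continuous_on UNIV g"
    unfolding g_def by (intro continuous_on_compose2[OF f] continuous_intros) auto
  then have "bounded (range g)" using at_top at_bot by (rule continuous_on_line_bounded)
  moreover have "f ` {c..} \<subseteq> range g" by (auto simp: g_def max_def image_iff)
  ultimately show ?thesis by (rule bounded_subset)
qed

lemma factored_quadratic_solution_unshift:
  fixes f q :: "real \<Rightarrow> real"
  assumes z: "factored_solution I (a + k) (b + k) F p z" and I: "{c..} \<subseteq> I"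
    and ab: "a > 0" "b > 0" and k: "k \<ge> 0"
    and f: "(f \<longlongrightarrow> 0) at_top" and q: "(q \<longlongrightarrow> 0) at_top" and z_bound: "z \<in> O(\<lambda>_. 1)"
    and eq: "\<And>t. t \<in> I \<Longrightarrow> F t = f t + k * (a + b + k) * z t - q t * (z t)\<^sup>2"
  shows "factored_solution I a b (\<lambda>t. f t - q t * (z t)\<^sup>2) (\<lambda>t. p t - k * z t) z"
    and "(z \<longlongrightarrow> 0) at_top"
proof -
  define G where "G t = f t - q t * (z t)\<^sup>2" for t
  have z2: "(\<lambda>t. (z t)\<^sup>2) \<in> O(\<lambda>_. 1)"
    using landau_o.big_power[OF z_bound, of 2] by simp
  have fq: "f \<in> o(\<lambda>_. 1)" "q \<in> o(\<lambda>_. 1)"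
    using f q by (simp_all add: smalloI_tendsto)
  have "(\<lambda>t. q t * (z t)\<^sup>2) \<in> o(\<lambda>_. 1)"
    using landau_o.small_big_mult[OF fq(2) z2] by simp
  then have G: "G \<in> o(\<lambda>_. 1)"
    unfolding G_def by (rule sum_in_smallo(2)[OF fq(1)])
  have "(\<lambda>t. k * (a + b + k) * z t) \<in> O(\<lambda>_. 1)"
    using z_bound by simp
  then have "(\<lambda>t. G t + k * (a + b + k) * z t) \<in> O(\<lambda>_. 1)"
    by (rule sum_in_bigo(1)[OF landau_o.small_imp_big[OF G]])
  moreover have "eventually (\<lambda>t. F t = G t + k * (a + b + k) * z t) at_top"
    using eventually_ge_at_top[of c] by eventually_elim (use I eq in \<open>auto simp: G_def\<close>)
  ultimately have F: "F \<in> O(\<lambda>_. 1)"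
    by (simp add: landau_o.big.in_cong)
  have "factored_solution I a b G (\<lambda>t. p t - k * z t) z"
    by (rule factored_solution_unshift[OF z I ab k F z_bound]) (simp add: eq G_def)
  then show "factored_solution I a b (\<lambda>t. f t - q t * (z t)\<^sup>2) (\<lambda>t. p t - k * z t) z"
    and "(z \<longlongrightarrow> 0) at_top"
    using smalloD_tendsto[OF G] factored_solution_tendsto_0[OF _ I ab]
    by (auto simp: G_def[abs_def])
qed

lemma quadratic_shift_exists:
  fixes s B :: real
  assumes "s > 0" "B \<ge> 0"
  obtains k where "k \<ge> 0" "2 * B \<le> k * (s + k)"
proof
  show "2 * B / s \<ge> 0" using assms by simp
  have "2 * B = 2 * B / s * s" using assms by simp
  also have "\<dots> \<le> 2 * B / s * (s + 2 * B / s)" using assms by (intro mult_left_mono) auto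
  finally show "2 * B \<le> 2 * B / s * (s + 2 * B / s)" .
qed

lemma half_line_shifted_quadratic_solution:
  fixes f q :: "real \<Rightarrow> real"
  assumes ab: "a > 0" "b > 0" and \<gamma>: "0 \<le> \<gamma>" "\<gamma> * b \<le> 1"
    and f: "continuous_on {0..} f" "\<And>t. 0 \<le> t \<Longrightarrow> 0 \<le> f t"
      "\<And>t. 0 \<le> t \<Longrightarrow> f t + K * C \<le> a * b * C"
    and q: "continuous_on {0..} q" "\<And>t. 0 \<le> t \<Longrightarrow> 0 \<le> q t" "\<And>t. 0 \<le> t \<Longrightarrow> 2 * (q t * C) \<le> K"
    and K: "0 \<le> K" "K < a * b" and C: "0 \<le> C"
  obtains p z where "factored_solution {0..} a b (\<lambda>t. f t + K * z t - q t * (z t)\<^sup>2) p z"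
    "z 0 = \<gamma> * p 0" "\<And>t. 0 \<le> t \<Longrightarrow> 0 \<le> z t" "\<And>t. 0 \<le> t \<Longrightarrow> z t \<le> C"
proof -
  interpret solver_with_comparison "half_line_solution a b \<gamma>" "a * b"
    using ab \<gamma> by (rule half_line_solver)
  obtain y where y: "half_line_solution a b \<gamma>
        (\<lambda>t. f (max 0 t) + K * y t - q (max 0 t) * (y t)\<^sup>2) y"
      and y_bounds: "\<And>t. 0 \<le> y t" "\<And>t. y t \<le> C"
  proof (rule quadratic_fixed_point[where f = "\<lambda>t. f (max 0 t)" and q = "\<lambda>t. q (max 0 t)"
        and \<rho> = "\<lambda>_. C" and K = K])
    show "z t \<le> C" if z: "half_line_solution a b \<gamma> F z"
      and F: "\<And>t. F t \<le> f (max 0 t) + K * C" for F z t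
    proof -
      have "F t \<le> a * b * C" for t
        using F[of t] f(3)[of "max 0 t"] by simp
      then have "z t \<le> a * b * C / (a * b)"
        using C ab by (intro solution_le[OF z]) auto
      then show ?thesis using ab by simp
    qed
    show "f (max 0 t) \<le> a * b * C - K * C" for t using f(3)[of "max 0 t"] by simp
  qed (use f q C K in \<open>auto intro!: continuous_on_compose2[OF f(1)]
      continuous_on_compose2[OF q(1)] continuous_intros\<close>)
  then obtain p z where z: "factored_solution {0..} a b
        (\<lambda>t. f (max 0 t) + K * y t - q (max 0 t) * (y t)\<^sup>2) p z" "z 0 = \<gamma> * p 0"
      and y_eq: "y = (\<lambda>t. z (max 0 t))"
    by (auto simp: half_line_solution_def)
  have "z t = y t" if "0 \<le> t" for t using that by (simp add: y_eq)
  with z y_bounds show ?thesis by (intro that[of z p]) (auto simp: factored_solution_def)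
qed

lemma half_line_quadratic_problem_solvable:
  fixes f q :: "real \<Rightarrow> real"
  assumes ab: "a > 0" "b > 0" and \<gamma>: "0 \<le> \<gamma>" "\<gamma> * b \<le> 1"
    and f: "continuous_on {0..} f" "\<And>t. 0 \<le> t \<Longrightarrow> 0 \<le> f t" "(f \<longlongrightarrow> 0) at_top"
    and q: "continuous_on {0..} q" "\<And>t. 0 \<le> t \<Longrightarrow> 0 \<le> q t" "(q \<longlongrightarrow> 0) at_top"
  obtains p z where "factored_solution {0..} a b (\<lambda>t. f t - q t * (z t)\<^sup>2) p z" "z 0 = \<gamma> * p 0"
    "(z \<longlongrightarrow> 0) at_top"
proof -
  obtain M where M: "\<And>t. 0 \<le> t \<Longrightarrow> f t \<le> M"
    using continuous_on_half_line_bounded[OF f(1,3)] by (fastforce simp: bounded_iff abs_le_iff)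
  obtain Q where Q: "\<And>t. 0 \<le> t \<Longrightarrow> q t \<le> Q"
    using continuous_on_half_line_bounded[OF q(1,3)] by (fastforce simp: bounded_iff abs_le_iff)
  define C where "C = M / (a * b)"
  have C: "0 \<le> C" "M = a * b * C"
    using f(2)[of 0] M[of 0] ab by (simp_all add: C_def)
  have "0 \<le> Q * C" using q(2)[of 0] Q[of 0] C(1) by simp
  then obtain k where k: "k \<ge> 0" "2 * (Q * C) \<le> k * (a + b + k)"
    using quadratic_shift_exists[of "a + b"] ab by auto
  define K where "K = k * (a + b + k)"
  have \<mu>: "(a + k) * (b + k) = a * b + K" by (simp add: K_def algebra_simps)
  \<comment> \<open>The inner function of the shifted system is \<open>p + k z\<close>, and \<open>z 0 = \<gamma>' (p 0 + k z 0)\<close> means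
    \<open>z 0 = \<gamma> p 0\<close>.\<close>
  define \<gamma>' where "\<gamma>' = \<gamma> / (1 + \<gamma> * k)"
  have \<gamma>k: "0 < 1 + \<gamma> * k" using \<gamma>(1) k(1) by (simp add: add_pos_nonneg)
  obtain p z where z: "factored_solution {0..} (a + k) (b + k)
        (\<lambda>t. f t + K * z t - q t * (z t)\<^sup>2) p z" "z 0 = \<gamma>' * p 0"
      and z_bounds: "\<And>t. 0 \<le> t \<Longrightarrow> 0 \<le> z t" "\<And>t. 0 \<le> t \<Longrightarrow> z t \<le> C"
  proof (rule half_line_shifted_quadratic_solution[where f = f and q = q and C = C and K = K])
    show "0 \<le> \<gamma>'" "\<gamma>' * (b + k) \<le> 1" using \<gamma> \<gamma>k by (auto simp: \<gamma>'_def field_simps)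
    show "2 * (q t * C) \<le> K" if "0 \<le> t" for t
      using k(2) mult_right_mono[OF Q[OF that] C(1)] by (simp add: K_def)
    show "f t + K * C \<le> (a + k) * (b + k) * C" if "0 \<le> t" for t
      unfolding \<mu> using M[OF that] C(2) by (simp add: distrib_right)
  qed (use f q C k(1) ab in \<open>auto simp: \<mu> K_def\<close>)
  have "z \<in> O(\<lambda>_. 1)"
    by (intro bigoI[where c = C] eventually_mono[OF eventually_ge_at_top[of 0]])
       (use z_bounds in auto)
  note unshifted = factored_quadratic_solution_unshift[OF z(1) order_refl ab k(1) f(3) q(3) this,
      folded K_def, OF refl]
  have "z 0 = \<gamma> * (p 0 - k * z 0)" using z(2) \<gamma>k by (simp add: \<gamma>'_def field_simps)
  with unshifted show ?thesis by (intro that)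
qed

lemma line_shifted_quadratic_solution:
  fixes f q :: "real \<Rightarrow> real"
  assumes ac: "0 < a" "c < a" and bc: "0 < b" "0 < b + c"
    and f: "continuous_on UNIV f" "\<And>t. 0 \<le> f t" "\<And>t. f t \<le> M"
      "\<And>t. f t + K * (C * exp (c * t)) \<le> (a - c) * (b + c) * C * exp (c * t)"
    and q: "continuous_on UNIV q" "\<And>t. 0 \<le> q t" "\<And>t. 2 * (q t * (C * exp (c * t))) \<le> K"
    and K: "0 \<le> K" "K < a * b" and C: "0 \<le> C"
  obtains p z where "factored_solution UNIV a b (\<lambda>t. f t + K * z t - q t * (z t)\<^sup>2) p z"
    "\<And>t. 0 \<le> z t" "\<And>t. z t \<le> C * exp (c * t)" "bounded (range z)"
proof -
  interpret solver_with_comparison "line_solution a b" "a * b"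
    using ac(1) bc(1) by (rule line_solver)
  have small: "(\<lambda>t. C * exp (c * t)) \<in> o[at_bot](\<lambda>t. exp (- b * t))"
    using exp_smallo_exp_at_bot[of "- b" c] bc(2) by simp
  obtain z where "line_solution a b (\<lambda>t. f t + K * z t - q t * (z t)\<^sup>2) z"
    "\<And>t. 0 \<le> z t" "\<And>t. z t \<le> C * exp (c * t)" "bounded (range z)"
  proof (rule quadratic_fixed_point[where f = f and q = q
        and \<rho> = "\<lambda>t. C * exp (c * t)" and K = K and M = M])
    show "z t \<le> C * exp (c * t)" if z: "line_solution a b F z"
      and F: "\<And>t. F t \<le> f t + K * (C * exp (c * t))" for F z t
    proof -
      obtain p where "factored_solution UNIV a b F p z" "z \<in> o[at_bot](\<lambda>t. exp (- b * t))"
        using z by (auto simp: line_solution_def)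
      then show ?thesis
        by (rule factored_solution_mono_line[OF _ _ factored_solution_exp[OF ac(2)] small])
           (rule order_trans[OF F f(4)])
    qed
  qed (use f q C K in auto)
  then show ?thesis using that by (auto simp: line_solution_def)
qed

lemma line_quadratic_problem_solvable:
  fixes f q :: "real \<Rightarrow> real"
  assumes c: "0 < c" "c < a" and b: "b > 0"
    and f: "continuous_on UNIV f" "\<And>t. 0 \<le> f t" "(f \<longlongrightarrow> 0) at_top" "\<And>t. f t \<le> M * exp (c * t)"
    and q: "continuous_on UNIV q" "\<And>t. 0 \<le> q t" "(q \<longlongrightarrow> 0) at_top" "\<And>t. q t * exp (c * t) \<le> Q"
  obtains p z where "factored_solution UNIV a b (\<lambda>t. f t - q t * (z t)\<^sup>2) p z"
    "(z \<longlongrightarrow> 0) at_top" "(z \<longlongrightarrow> 0) at_bot"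
proof -
  have a: "a > 0" using c by simp
  have weight_tendsto_0: "((\<lambda>t. d * exp (c * t)) \<longlongrightarrow> 0) at_bot" for d
    using c(1) by real_asymp
  have "(f \<longlongrightarrow> 0) at_bot"
    by (rule tendsto_sandwich[OF _ _ tendsto_const weight_tendsto_0[of M]]) (use f in auto)
  then obtain M' where M': "\<And>t. f t \<le> M'"
    using continuous_on_line_bounded[OF f(1,3)] by (fastforce simp: bounded_iff abs_le_iff)
  define C where "C = M / ((a - c) * (b + c))"
  have "0 \<le> M" using f(2)[of 0] f(4)[of 0] by simp
  then have C: "0 \<le> C" "M = (a - c) * (b + c) * C"
    using b c by (simp_all add: C_def)
  have "0 \<le> Q * C" using q(2,4)[of 0] C(1) by simp
  then obtain k where k: "k \<ge> 0" "2 * (Q * C) \<le> k * (a + b + k)"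
    using quadratic_shift_exists[of "a + b"] a b by auto
  define K where "K = k * (a + b + k)"
  obtain p z where z: "factored_solution UNIV (a + k) (b + k)
        (\<lambda>t. f t + K * z t - q t * (z t)\<^sup>2) p z"
      and z_bounds: "\<And>t. 0 \<le> z t" "\<And>t. z t \<le> C * exp (c * t)" "bounded (range z)"
  proof (rule line_shifted_quadratic_solution[where f = f and q = q and C = C and c = c and K = K])
    show "f t + K * (C * exp (c * t)) \<le> (a + k - c) * (b + k + c) * C * exp (c * t)" for t
      using f(4)[of t] by (simp add: C(2) K_def algebra_simps)
    show "2 * (q t * (C * exp (c * t))) \<le> K" for t
      using k(2) mult_right_mono[OF q(4)[of t] C(1)] by (simp add: K_def algebra_simps)
    show "K < (a + k) * (b + k)" using a b by (simp add: K_def algebra_simps)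
    show "0 \<le> K" using a b k(1) by (simp add: K_def)
  qed (use f q M' C(1) k(1) a b c in auto)
  note unshifted = factored_quadratic_solution_unshift[OF z subset_UNIV a b k(1) f(3) q(3)
      bounded_range_imp_bigo_1[OF z_bounds(3)], folded K_def, OF refl]
  have "(z \<longlongrightarrow> 0) at_bot"
    by (rule tendsto_sandwich[OF _ _ tendsto_const weight_tendsto_0[of C]]) (use z_bounds in auto)
  with unshifted show ?thesis by (intro that)
qed

section \<open>The source term\<close>

lemma set_integral_nonneg_AE:
  fixes g :: "'a \<Rightarrow> real"
  assumes "AE x in M. x \<in> A \<longrightarrow> 0 \<le> g x"
  shows "0 \<le> (LINT x:A|M. g x)"
  unfolding set_lebesgue_integral_def
  using assms by (intro integral_nonneg_AE) (auto simp: indicator_def elim!: eventually_mono)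

lemma set_integral_mono_set_AE:
  fixes g :: "'a \<Rightarrow> real"
  assumes g: "set_integrable M B g" and nonneg: "AE x in M. x \<in> B \<longrightarrow> 0 \<le> g x"
    and A: "A \<subseteq> B" "A \<in> sets M"
  shows "(LINT x:A|M. g x) \<le> (LINT x:B|M. g x)"
  unfolding set_lebesgue_integral_def
  using set_integrable_subset[OF g A(2,1)] g nonneg A(1)
  by (intro integral_mono_AE) (auto simp: indicator_def set_integrable_def elim!: eventually_mono)

lemma src_continuous_on:
  assumes "set_integrable lborel {0..R} g"
  shows "continuous_on {t. exp (- t) \<le> R} (src N g)"
proof -
  define I where "I r = integral {0..r} g" for r
  have g: "g integrable_on {0..R}"
    using set_borel_integral_eq_integral(1)[OF assms] .
  have "src N g t = exp ((real N - 3) * t) * I (exp (- t))" if "exp (- t) \<le> R" for t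
  proof -
    have "set_integrable lborel {0..exp (- t)} g"
      by (rule set_integrable_subset[OF assms]) (use that in auto)
    then show ?thesis
      unfolding src_def I_def by (simp add: set_borel_integral_eq_integral(2))
  qed
  moreover have "continuous_on {t. exp (- t) \<le> R} (\<lambda>t. exp ((real N - 3) * t) * I (exp (- t)))"
    unfolding I_def
    by (intro continuous_intros continuous_on_compose2[OF indefinite_integral_continuous_1[OF g]]) auto
  ultimately show ?thesis
    by (simp cong: continuous_on_cong_simp)
qed

lemma src_continuous_on_UNIV:
  assumes g: "set_integrable lborel {0..} g"
  shows "continuous_on UNIV (src N g)"
proof (rule continuous_at_imp_continuous_on, rule ballI)
  fix t :: real
  have "set_integrable lborel {0..exp (1 - t)} g"
    by (rule set_integrable_subset[OF g]) auto
  then have "continuous_on {t - 1<..} (src N g)"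
    by (rule continuous_on_subset[OF src_continuous_on]) auto
  then show "isCont (src N g) t"
    by (simp add: continuous_on_eq_continuous_at)
qed

lemma src_nonneg:
  assumes "AE s in lborel. s \<in> {0..exp (- t)} \<longrightarrow> 0 \<le> g s"
  shows "0 \<le> src N g t"
  unfolding src_def using set_integral_nonneg_AE[OF assms] by simp

lemma src_le_exp_mult_integral:
  assumes "set_integrable lborel {0..} g" "AE s in lborel. s \<in> {0..} \<longrightarrow> 0 \<le> g s"
  shows "src N g t \<le> exp ((real N - 3) * t) * (LINT s:{0..}|lborel. g s)"
  unfolding src_def using assms by (intro mult_left_mono set_integral_mono_set_AE) auto

lemma src_le_exp_mult_src:
  assumes g: "set_integrable lborel {0..} g" "AE s in lborel. s \<in> {0..} \<longrightarrow> 0 \<le> g s" and "s \<le> t"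
  shows "src N g t \<le> exp ((real N - 3) * (t - s)) * src N g s"
proof -
  have "(LINT r:{0..exp (- t)}|lborel. g r) \<le> (LINT r:{0..exp (- s)}|lborel. g r)"
    by (rule set_integral_mono_set_AE[OF set_integrable_subset[OF g(1)]])
       (use g(2) \<open>s \<le> t\<close> in \<open>auto elim!: eventually_mono\<close>)
  then have "src N g t \<le> exp ((real N - 3) * t) * (LINT r:{0..exp (- s)}|lborel. g r)"
    unfolding src_def by (rule mult_left_mono) simp
  also have "\<dots> = exp ((real N - 3) * (t - s)) * src N g s"
    unfolding src_def by (simp add: algebra_simps flip: exp_add)
  finally show ?thesis .
qed

lemma src_eq_0_if_tendsto_0_at_bot:
  assumes g: "set_integrable lborel {0..} g" "AE s in lborel. s \<in> {0..} \<longrightarrow> 0 \<le> g s"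
    and lim: "(src N g \<longlongrightarrow> 0) at_bot" and N: "N \<le> 3"
  shows "src N g t = 0"
proof (rule antisym)
  have nonneg: "0 \<le> src N g s" for s
    using g(2) by (intro src_nonneg) (auto elim!: eventually_mono)
  have "src N g t \<le> src N g s" if "s \<le> t" for s
  proof -
    have "exp ((real N - 3) * (t - s)) \<le> 1"
      using N that by (simp add: mult_nonpos_nonneg)
    then have "exp ((real N - 3) * (t - s)) * src N g s \<le> 1 * src N g s"
      using nonneg by (rule mult_right_mono)
    then show ?thesis using src_le_exp_mult_src[OF g that, of N] by simp
  qed
  then have "eventually (\<lambda>s. src N g t \<le> src N g s) at_bot"
    unfolding eventually_at_bot_linorder by blast
  then show "src N g t \<le> 0" by (rule tendsto_lowerbound[OF lim]) simp
  show "0 \<le> src N g t" by (rule nonneg)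
qed

lemma src_le_mult_exp:
  assumes g: "set_integrable lborel {0..} g" "AE s in lborel. s \<in> {0..} \<longrightarrow> 0 \<le> g s"
    and lim: "(src N g \<longlongrightarrow> 0) at_top" and N: "N \<ge> 4"
  obtains M where "\<And>t. src N g t \<le> M * exp t"
proof -
  define J where "J = (LINT s:{0..}|lborel. g s)"
  have J: "0 \<le> J" unfolding J_def by (rule set_integral_nonneg_AE[OF g(2)])
  have "bounded (src N g ` {0..})"
    by (rule continuous_on_half_line_bounded[OF _ lim])
       (rule continuous_on_subset[OF src_continuous_on_UNIV[OF g(1)] subset_UNIV])
  then obtain B where B: "\<And>t. 0 \<le> t \<Longrightarrow> \<bar>src N g t\<bar> \<le> B"
    by (auto simp: bounded_iff)
  have "src N g t \<le> max B J * exp t" for t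
  proof (cases "0 \<le> t")
    case True
    have "src N g t \<le> B * 1" using B[OF True] by simp
    also have "\<dots> \<le> max B J * exp t" using True J by (intro mult_mono) auto
    finally show ?thesis .
  next
    case False
    have "(real N - 3) * t \<le> 1 * t" using False N by (intro mult_right_mono_neg) auto
    then have "exp ((real N - 3) * t) * J \<le> exp t * max B J"
      using J by (intro mult_mono) auto
    then show ?thesis
      using src_le_exp_mult_integral[OF g, of N t] by (simp add: J_def mult.commute)
  qed
  then show ?thesis by (rule that)
qed

section \<open>The radial problems\<close>

lemma factored_solution_solves_ode:
  assumes z: "factored_solution S (real N - 1) 1
      (\<lambda>t. - lam * src N g t - (real N - 1) / 2 * exp (- t) * (z t)\<^sup>2) p z"
    and src: "continuous_on S (src N g)"
  obtains w2 where "C2_with S (\<lambda>t. - z t) (\<lambda>t. z t - p t) w2"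
    "\<forall>t\<in>S. ode_at N lam g (\<lambda>t. - z t) (\<lambda>t. z t - p t) w2 t"
proof
  define F where "F t = - lam * src N g t - (real N - 1) / 2 * exp (- t) * (z t)\<^sup>2" for t
  define w2 where "w2 t = (p t - 1 * z t) - ((real N - 1) * p t - F t)" for t
  note deriv = factored_solutionD(1,2)[OF z, folded F_def, THEN has_field_derivative_at_within]
  have "continuous_on S w2"
    unfolding w2_def F_def by (intro continuous_intros factored_solution_continuous_on[OF z] src)
  then show "C2_with S (\<lambda>t. - z t) (\<lambda>t. z t - p t) w2"
    unfolding C2_with_def w2_def by (auto intro!: derivative_eq_intros deriv)
  show "\<forall>t\<in>S. ode_at N lam g (\<lambda>t. - z t) (\<lambda>t. z t - p t) w2 t"
    by (simp add: ode_at_def w2_def F_def algebra_simps)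
qed

lemma half_line_radial_problem_solvable:
  assumes N: "N \<ge> 2" and lam: "lam < 0" and g: "g_hyp_D N g" and \<gamma>: "0 \<le> \<gamma>" "\<gamma> \<le> 1"
  obtains w w1 w2 where "C2_with {0..} w w1 w2" "\<forall>t\<ge>0. ode_at N lam g w w1 w2 t"
    "w 0 = \<gamma> * (w 0 + w1 0)" "(w \<longlongrightarrow> 0) at_top"
proof -
  have g_props: "set_integrable lborel {0..1} g" "(src N g \<longlongrightarrow> 0) at_top"
    "AE s in lborel. s \<in> {0..1} \<longrightarrow> 0 \<le> g s"
    using g by (auto simp: g_hyp_D_def)
  have src: "continuous_on {0..} (src N g)"
    by (rule continuous_on_subset[OF src_continuous_on[OF g_props(1)]]) auto
  have src_ge_0: "0 \<le> src N g t" if "0 \<le> t" for t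
  proof (rule src_nonneg)
    have "exp (- t) \<le> 1" using that by simp
    then have "{0..exp (- t)} \<subseteq> {0..1}" by auto
    with g_props(3) show "AE s in lborel. s \<in> {0..exp (- t)} \<longrightarrow> 0 \<le> g s"
      by (elim eventually_mono) blast
  qed
  obtain p z where z: "factored_solution {0..} (real N - 1) 1
        (\<lambda>t. - lam * src N g t - (real N - 1) / 2 * exp (- t) * (z t)\<^sup>2) p z"
      and boundary: "z 0 = \<gamma> * p 0" and z_lim: "(z \<longlongrightarrow> 0) at_top"
  proof (rule half_line_quadratic_problem_solvable)
    show "0 \<le> - lam * src N g t" if "0 \<le> t" for t
      using lam src_ge_0[OF that] by (simp add: mult_nonpos_nonneg)
    show "((\<lambda>t. - lam * src N g t) \<longlongrightarrow> 0) at_top"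
      using g_props(2) by (rule tendsto_mult_right_zero)
    show "((\<lambda>t. (real N - 1) / 2 * exp (- t)) \<longlongrightarrow> 0) at_top" by real_asymp
  qed (use N \<gamma> in \<open>auto intro!: continuous_intros src\<close>)
  obtain w2 where w2: "C2_with {0..} (\<lambda>t. - z t) (\<lambda>t. z t - p t) w2"
    "\<forall>t\<in>{0..}. ode_at N lam g (\<lambda>t. - z t) (\<lambda>t. z t - p t) w2 t"
    using factored_solution_solves_ode[OF z src] .
  show ?thesis
  proof (rule that[OF w2(1)])
    show "- z 0 = \<gamma> * (- z 0 + (z 0 - p 0))" using boundary by simp
    show "((\<lambda>t. - z t) \<longlongrightarrow> 0) at_top" using tendsto_minus[OF z_lim] by simp
  qed (use w2(2) in auto)
qed

lemma solves_E_zero: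
  assumes "\<And>t. src N g t = 0"
  shows "solves_E N lam g (\<lambda>t. 0)"
  unfolding solves_E_def C2_with_def ode_at_def
  using assms by (intro exI[of _ "\<lambda>t. 0"]) auto

lemma entire_radial_problem_solvable:
  assumes lam: "lam < 0" and g: "g_hyp_E N g"
  shows "\<exists>w. solves_E N lam g w"
proof -
  have g_props: "set_integrable lborel {0..} g" "AE s in lborel. s \<in> {0..} \<longrightarrow> 0 \<le> g s"
    and src_lim: "(src N g \<longlongrightarrow> 0) at_top" "(src N g \<longlongrightarrow> 0) at_bot"
    using g by (auto simp: g_hyp_E_def)
  show ?thesis
  proof (cases "N \<le> 3")
    case True
    then show ?thesis
      using solves_E_zero src_eq_0_if_tendsto_0_at_bot[OF g_props src_lim(2)] by blast
  next
    case False
    have src: "continuous_on UNIV (src N g)" by (rule src_continuous_on_UNIV[OF g_props(1)])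
    have src_ge_0: "0 \<le> src N g t" for t
      using g_props(2) by (intro src_nonneg) (auto elim!: eventually_mono)
    obtain M where M: "\<And>t. src N g t \<le> M * exp t"
      using src_le_mult_exp[OF g_props src_lim(1)] False by auto
    obtain p z where z: "factored_solution UNIV (real N - 1) 1
          (\<lambda>t. - lam * src N g t - (real N - 1) / 2 * exp (- t) * (z t)\<^sup>2) p z"
        and z_lim: "(z \<longlongrightarrow> 0) at_top" "(z \<longlongrightarrow> 0) at_bot"
    proof (rule line_quadratic_problem_solvable)
      show "- lam * src N g t \<le> - lam * M * exp (1 * t)" for t
        using M[of t] lam by simp
      show "(real N - 1) / 2 * exp (- t) * exp (1 * t) \<le> (real N - 1) / 2" for t
        by (simp add: mult.assoc flip: exp_add)
      show "0 \<le> - lam * src N g t" for t using lam src_ge_0 by (simp add: mult_nonpos_nonneg)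
      show "((\<lambda>t. - lam * src N g t) \<longlongrightarrow> 0) at_top"
        using src_lim(1) by (rule tendsto_mult_right_zero)
      show "((\<lambda>t. (real N - 1) / 2 * exp (- t)) \<longlongrightarrow> 0) at_top" by real_asymp
    qed (use False in \<open>auto intro!: continuous_intros src\<close>)
    obtain w2 where "C2_with UNIV (\<lambda>t. - z t) (\<lambda>t. z t - p t) w2"
      "\<forall>t\<in>UNIV. ode_at N lam g (\<lambda>t. - z t) (\<lambda>t. z t - p t) w2 t"
      using factored_solution_solves_ode[OF z src] .
    then have "solves_E N lam g (\<lambda>t. - z t)"
      using z_lim[THEN tendsto_minus] unfolding solves_E_def by auto
    then show ?thesis by blast
  qed
qed

theorem theorem4p15:
  fixes N :: nat and lam :: real
  assumes "N \<ge> 2" and "lam < 0"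
  shows "(\<forall>g. g_hyp_D N g \<longrightarrow> (\<exists>w. solves_D N lam g w))
       \<and> (\<forall>g. g_hyp_D N g \<longrightarrow> (\<exists>w. solves_Nav N lam g w))
       \<and> (\<forall>g. g_hyp_E N g \<longrightarrow> (\<exists>w. solves_E N lam g w))"
proof (intro conjI allI impI)
  fix g assume g: "g_hyp_D N g"
  show "\<exists>w. solves_D N lam g w"
    by (rule half_line_radial_problem_solvable[OF assms g, of 0]) (auto simp: solves_D_def)
  obtain w w1 w2 where w: "C2_with {0..} w w1 w2" "\<forall>t\<ge>0. ode_at N lam g w w1 w2 t"
      "w 0 = 1 / real N * (w 0 + w1 0)" "(w \<longlongrightarrow> 0) at_top"
    using half_line_radial_problem_solvable[OF assms g, of "1 / real N"] \<open>N \<ge> 2\<close> by auto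
  then have "w1 0 - (real N - 1) * w 0 = 0"
    using \<open>N \<ge> 2\<close> by (simp add: field_simps)
  with w show "\<exists>w. solves_Nav N lam g w"
    unfolding solves_Nav_def by blast
qed (rule entire_radial_problem_solvable[OF \<open>lam < 0\<close>])

end
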